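(* Let rML-GDP-HR denote the continuous relaxation of the mixed-integer program obtained from a Multi-Level Nested GDP via the Hull reformulation, and let rME-GDP-HR denote the continuous relaxation of the mixed-integer program obtained from its respective Equivalent Single-Level GDP representation via the Hull reformulation. Then the feasible space of the former is contained within the feasible space of the latter, namely $$\text{rML-GDP-HR}\subseteq\text{rME-GDP-HR}.$$
   Context: **Generalities.** A Generalized Disjunctive Program (GDP) minimizes $f(x)$ over continuous variables $x\in\mathbb{R}^N$, $x^{LB}\le x\le x^{UB}$, subject to global constraints $r(x)\le 0$, disjunctions, and logic constraints $\Omega$ on Boolean variables. Each disjunct of a disjunction has an indicator Boolean; if it is True, the constraints in that disjunct are enforced. The objective and constraint functions are assumed continuous and differentiable. The predicate $\Xi(m,\,Y_s\ \forall s\in S)$ means that exactly $m$ of the Booleans $Y_s$ are True; if $m$ is replaced by a Boolean $Y$, it stands for $1$ when $Y$ is True and $0$ when $Y$ is False. **Multi-Level Nested GDP (ML-GDP), $n$ levels.** For each $i_1\in I^{(1)}$ there is a level-1 disjunction over $j_1\in J^{(1)}_{i_1}$. Its disjunct $j_1$ has indicator $Y^{(1)}_{i_1j_1}$ and contains the constraints $g^{(1)}_{i_1j_1}(x)\le 0$ together with nested level-2 disjunctions, one for each $i_2\in I^{(2)}_{i_1j_1}$, over $j_2\in J^{(2)}_{i_1j_1i_2}$. The disjuncts of these have indicators $Y^{(2)}_{i_1j_1i_2j_2}$ and contain $g^{(2)}_{i_1j_1i_2j_2}(x)\le 0$ together with nested level-3 disjunctions, and so on down to level $n$. The logic constraints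 are $\Xi(1,Y^{(1)}_{i_1j_1}\ \forall j_1\in J^{(1)}_{i_1})$ for each level-1 disjunction, $\Xi\big(Y^{(k-1)}_{i_1j_1\dots i_{k-1}j_{k-1}},\,Y^{(k)}_{i_1j_1\dots i_kj_k}\ \forall j_k\in J^{(k)}_{i_1j_1\dots i_k}\big)$ for each level-$k$ disjunction, $k=2,\dots,n$, and $\Omega(Y^{(1)},\dots,Y^{(n)})$. **Equivalent Single-Level GDP.** Every nested disjunction is extracted to the top level, and a "slack" disjunct with a new slack Boolean, whose only constraint is $x^{LB}\le x\le x^{UB}$, is added to it. The cardinality rule that exactly one disjunct is selected in the extracted disjunction (slack disjunct included) is added. The linking rule between the parent Boolean and the nested Booleans (slack Boolean not included), all other logic constraints, $f$, $r$ and the bounds are kept. **Hull reformulation.** Booleans are replaced by binaries, the continuous variables are disaggregated over the disjuncts of each disjunction, the constraints in a disjunct are replaced by their perspective functions, and logic constraints become linear constraints. For a nested GDP, the variable disaggregated over a nested disjunction is the disaggregated variable of its parent disjunct; for the Equivalent Single-Level GDP, $x$ itself is disaggregated over every disjunction. The continuous relaxation replaces each binary by a variable in $[0,1]$. **The two-level case, explicitly.** The upper-level disjunctions $i\in I$ have disjuncts $j\in J_i$ with Boolean $Y_{ij}$ and constraints $g_{ij}(x)\le0$. The disjunctions $k\in K_{ij}$ nested in disjunct $(i,j)$ have disjuncts $l\in L_{ijk}$ with Boolean $W_{ijkl}$ and constraints $h_{ijkl}(x)\le0$. Binaries are $y_{ij},w_{ijkl}$; the slack disjunct is indexed by $l=0$.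 Constraints hold for all applicable indices (with $L_{ijk}\ne\emptyset$). *Hull reformulation of the nested model:* minimize $f(x)$ subject to - $r(x)\le 0$; - $\sum_{j\in J_i}u_{ij}=x$ and $\sum_{l\in L_{ijk}}v_{ijkl}=u_{ij}$; - $x^{LB}y_{ij}\le u_{ij}\le x^{UB}y_{ij}$ and $x^{LB}w_{ijkl}\le v_{ijkl}\le x^{UB}w_{ijkl}$; - $y_{ij}\,g_{ij}(u_{ij}/y_{ij})\le 0$ and $w_{ijkl}\,h_{ijkl}(v_{ijkl}/w_{ijkl})\le 0$ for $l\in L_{ijk}$; - $\sum_{j\in J_i}y_{ij}=1$ and $y_{ij}=\sum_{l\in L_{ijk}}w_{ijkl}$; - $Ay+Bw\le c$ (the algebraic form of the other logic constraints $\Omega$, with constant $A,B,c$); - $x^{LB}\le x\le x^{UB}$, $\min(0,x^{LB})\le u_{ij}\le\max(0,x^{UB})$, $\min(0,x^{LB})\le v_{ijkl}\le\max(0,x^{UB})$, with $x,u_{ij},v_{ijkl}\in\mathbb{R}^N$ and $y_{ij},w_{ijkl}\in\{0,1\}$. *Hull reformulation of the Equivalent Single-Level model:* the same, except that $\sum_{l\in L_{ijk}}v_{ijkl}=u_{ij}$ is replaced by $v_{ijk0}+\sum_{l\in L_{ijk}}v_{ijkl}=x$; the constraint $w_{ijk0}+\sum_{l\in L_{ijk}}w_{ijkl}=1$ is added; and the bounds $x^{LB}w_{ijkl}\le v_{ijkl}\le x^{UB}w_{ijkl}$ and the domains of $v_{ijkl}$ and $w_{ijkl}$ are imposed for $l\in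 L_{ijk}\cup\{0\}$. The variables $v_{ijk0}$ and $w_{ijk0}$ occur only in this second model. *)

theory Defs
  imports "HOL-Analysis.Analysis"
begin

section \<open>Mixed-integer programs\<close>

text \<open>\<open>mip_binaries\<close> is the set of coordinate functions that have to take the values 0 and 1.\<close>

record 'p mip =
  mip_objective :: "'p \<Rightarrow> real"
  mip_constraint :: "'p \<Rightarrow> bool"
  mip_binaries :: "('p \<Rightarrow> real) set"

definition feasible_space :: "'p mip \<Rightarrow> 'p set" where
  "feasible_space M = {z. mip_constraint M z \<and> (\<forall>b\<in>mip_binaries M. b z \<in> {0, 1})}"

definition continuous_relaxation :: "'p mip \<Rightarrow> 'p mip" where
  "continuous_relaxation M =
     \<lparr>mip_objective = mip_objective M,
      mip_constraint = (\<lambda>z. mip_constraint M z \<and> (\<forall>b\<in>mip_binaries M. b z \<in> {0..1})),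
      mip_binaries = {}\<rparr>"

section \<open>Generalized disjunctive programs\<close>

text \<open>
  The disjunct reached by choosing $j_1$ in disjunction $i_1$, then $j_2$ in the nested disjunction
  $i_2$, ..., $j_k$ in $i_k$ is named by the path \<open>[(i\<^sub>1,j\<^sub>1),\<dots>,(i\<^sub>k,j\<^sub>k)]\<close>; its Boolean indicator is
  named by the same path. The empty path is the top level of the model and carries no indicator.
\<close>

type_synonym ('i, 'j) path = "('i \<times> 'j) list"

text \<open>
  A pair \<open>(m, S)\<close> with \<open>m :: 'b cardinality\<close> and \<open>S :: 'b set\<close> stands for the predicate
  $\Xi(m, Y_s\ \forall s \in S)$; \<open>Truth b\<close> is the number 1 if $Y_b$ is True and 0 otherwise.
\<close>

datatype 'b cardinality = Exactly nat | Truth 'b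

text \<open>
  \<open>disjunctions_at G p\<close> indexes the disjunctions directly inside disjunct \<open>p\<close> (those of level 1 if
  \<open>p = []\<close>) and \<open>disjuncts_of G p i\<close> the disjuncts of the \<open>i\<close>-th of them. A constraint function \<open>h\<close>
  stands for $h(x) \le 0$, and a vector-valued constraint is given by the set of its components.
  \<open>logic G\<close> is $\Omega$, and a member \<open>(a, c)\<close> of \<open>logic_rows G\<close> is a row $a^T y \le c$ of its
  algebraic form.
\<close>

record ('i, 'j, 'n) gdp =
  objective :: "real^'n \<Rightarrow> real"
  global_constraints :: "(real^'n \<Rightarrow> real) set"
  lower_bound :: "real^'n"
  upper_bound :: "real^'n"
  disjunctions_at :: "('i, 'j) path \<Rightarrow> 'i set"
  disjuncts_of :: "('i, 'j) path \<Rightarrow> 'i \<Rightarrow> 'j set"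
  disjunct_constraints :: "('i, 'j) path \<Rightarrow> (real^'n \<Rightarrow> real) set"
  cardinality_rules :: "(('i, 'j) path cardinality \<times> ('i, 'j) path set) set"
  logic :: "(('i, 'j) path \<Rightarrow> bool) \<Rightarrow> bool"
  logic_rows :: "((('i, 'j) path \<Rightarrow> real) \<times> real) set"

inductive_set nodes :: "('i, 'j, 'n::finite) gdp \<Rightarrow> ('i, 'j) path set"
  for G :: "('i, 'j, 'n) gdp" where
  root: "[] \<in> nodes G"
| child: "p \<in> nodes G \<Longrightarrow> i \<in> disjunctions_at G p \<Longrightarrow> j \<in> disjuncts_of G p i
    \<Longrightarrow> p @ [(i, j)] \<in> nodes G"

definition disjuncts :: "('i, 'j, 'n::finite) gdp \<Rightarrow> ('i, 'j) path set" where
  "disjuncts G = nodes G - {[]}"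

text \<open>A nested disjunction with an empty index set of disjuncts is not part of the model.\<close>

definition disjunctions :: "('i, 'j, 'n::finite) gdp \<Rightarrow> (('i, 'j) path \<times> 'i) set" where
  "disjunctions G =
     {(p, i). p \<in> nodes G \<and> i \<in> disjunctions_at G p \<and> (p = [] \<or> disjuncts_of G p i \<noteq> {})}"

definition members :: "('i, 'j, 'n::finite) gdp \<Rightarrow> ('i, 'j) path \<Rightarrow> 'i \<Rightarrow> ('i, 'j) path set" where
  "members G p i = (\<lambda>j. p @ [(i, j)]) ` disjuncts_of G p i"

definition multilevel_gdp :: "nat \<Rightarrow> ('i, 'j, 'n::finite) gdp \<Rightarrow> bool" where
  "multilevel_gdp n G \<longleftrightarrow>
     1 \<le> n \<and>
     (\<forall>p\<in>nodes G. finite (disjunctions_at G p) \<and>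
        (\<forall>i\<in>disjunctions_at G p. finite (disjuncts_of G p i)) \<and>
        (n \<le> length p \<longrightarrow> disjunctions_at G p = {})) \<and>
     finite (global_constraints G) \<and>
     (\<forall>p\<in>disjuncts G. finite (disjunct_constraints G p)) \<and>
     (\<forall>h \<in> {objective G} \<union> global_constraints G \<union> (\<Union>p\<in>disjuncts G. disjunct_constraints G p).
        h differentiable_on {lower_bound G..upper_bound G}) \<and>
     cardinality_rules G =
       {(Exactly 1, members G [] i) | i. i \<in> disjunctions_at G []} \<union>
       {(Truth p, members G p i) | p i. (p, i) \<in> disjunctions G \<and> p \<noteq> []} \<and>
     finite (logic_rows G) \<and>
     (\<forall>Y. logic G Y \<longleftrightarrow>
        (\<forall>(a, c)\<in>logic_rows G. (\<Sum>p\<in>disjuncts G. a p * of_bool (Y p)) \<le> c))"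

section \<open>Equivalent Single-Level GDP\<close>

text \<open>
  Disjunction \<open>(p, i)\<close> of the nested model becomes the level-1 disjunction with index \<open>(p, i)\<close>. Its
  disjunct \<open>j\<close> becomes \<open>Some j\<close>, and \<open>None\<close> is the slack disjunct. \<open>extracted p\<close> is the new name of
  the disjunct, and of the Boolean, that is called \<open>p\<close> in the nested model.
\<close>

definition extracted :: "('i, 'j) path \<Rightarrow> (('i, 'j) path \<times> 'i, 'j option) path" where
  "extracted p = [((butlast p, fst (last p)), Some (snd (last p)))]"

definition bound_constraints :: "real^'n::finite \<Rightarrow> real^'n \<Rightarrow> (real^'n \<Rightarrow> real) set" where
  "bound_constraints l u = range (\<lambda>k z. l $ k - z $ k) \<union> range (\<lambda>k z. z $ k - u $ k)"

definition single_level_gdp ::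
  "('i, 'j, 'n::finite) gdp \<Rightarrow> (('i, 'j) path \<times> 'i, 'j option, 'n) gdp" where
  "single_level_gdp G =
     \<lparr>objective = objective G,
      global_constraints = global_constraints G,
      lower_bound = lower_bound G,
      upper_bound = upper_bound G,
      disjunctions_at = (\<lambda>q. if q = [] then disjunctions G else {}),
      disjuncts_of = (\<lambda>q (p, i). if q = []
         then Some ` disjuncts_of G p i \<union> (if p = [] then {} else {None}) else {}),
      disjunct_constraints = (\<lambda>q. case q of
           [((p, i), Some j)] \<Rightarrow> disjunct_constraints G (p @ [(i, j)])
         | [((p, i), None)] \<Rightarrow> bound_constraints (lower_bound G) (upper_bound G)
         | _ \<Rightarrow> {}),
      cardinality_rules =
        map_prod (map_cardinality extracted) (image extracted) ` cardinality_rules G \<union>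
        {(Exactly 1, insert [((p, i), None)] (extracted ` members G p i)) | p i.
           (p, i) \<in> disjunctions G \<and> p \<noteq> []},
      logic = (\<lambda>Y. logic G (Y \<circ> extracted)),
      logic_rows = (\<lambda>(a, c). (\<lambda>q. case q of
           [((p, i), Some j)] \<Rightarrow> a (p @ [(i, j)])
         | _ \<Rightarrow> 0, c)) ` logic_rows G\<rparr>"

section \<open>Hull reformulation\<close>

text \<open>
  Division by zero is zero, so the perspective vanishes for \<open>t = 0\<close>. The Hull reformulation
  evaluates it there only at \<open>v = 0\<close>, where 0 is the customary continuous extension.
\<close>

definition perspective :: "(real^'n \<Rightarrow> real) \<Rightarrow> real^'n \<Rightarrow> real \<Rightarrow> real" where
  "perspective h v t = t * h (v /\<^sub>R t)"

fun cardinality_value :: "('b \<Rightarrow> real) \<Rightarrow> 'b cardinality \<Rightarrow> real" where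
  "cardinality_value y (Exactly m) = real m"
| "cardinality_value y (Truth b) = y b"

text \<open>
  A point \<open>(x, v, y)\<close> consists of the original continuous variables, the disaggregated variables and
  the binaries. The families \<open>v\<close> and \<open>y\<close> are indexed by the disjuncts; extensionality pins down their
  values outside this index set. The disaggregated variables of a disjunction sum up to the
  disaggregated variable of the parent disjunct, which is \<open>x\<close> for a disjunction of level 1.
\<close>

type_synonym ('i, 'j, 'n) hull_point =
  "(real^'n) \<times> (('i, 'j) path \<Rightarrow> real^'n) \<times> (('i, 'j) path \<Rightarrow> real)"

definition hull_constraint :: "('i, 'j, 'n::finite) gdp \<Rightarrow> ('i, 'j, 'n) hull_point \<Rightarrow> bool" where
  "hull_constraint G = (\<lambda>(x, v, y).
     v \<in> extensional (disjuncts G) \<and>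
     y \<in> extensional (disjuncts G) \<and>
     (\<forall>r\<in>global_constraints G. r x \<le> 0) \<and>
     (\<forall>(p, i)\<in>disjunctions G.
        (\<Sum>q\<in>members G p i. v q) = (if p = [] then x else v p)) \<and>
     (\<forall>p\<in>disjuncts G. y p *\<^sub>R lower_bound G \<le> v p \<and> v p \<le> y p *\<^sub>R upper_bound G) \<and>
     (\<forall>p\<in>disjuncts G. \<forall>h\<in>disjunct_constraints G p. perspective h (v p) (y p) \<le> 0) \<and>
     (\<forall>(m, S)\<in>cardinality_rules G. (\<Sum>s\<in>S. y s) = cardinality_value y m) \<and>
     (\<forall>(a, c)\<in>logic_rows G. (\<Sum>p\<in>disjuncts G. a p * y p) \<le> c) \<and>
     lower_bound G \<le> x \<and> x \<le> upper_bound G \<and>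
     (\<forall>p\<in>disjuncts G. inf 0 (lower_bound G) \<le> v p \<and> v p \<le> sup 0 (upper_bound G)))"

definition hull_reformulation :: "('i, 'j, 'n::finite) gdp \<Rightarrow> ('i, 'j, 'n) hull_point mip" where
  "hull_reformulation G =
     \<lparr>mip_objective = (\<lambda>(x, v, y). objective G x),
      mip_constraint = hull_constraint G,
      mip_binaries = (\<lambda>p (x, v, y). y p) ` disjuncts G\<rparr>"

section \<open>Comparing the two models\<close>

text \<open>
  The variables of the slack disjuncts occur only in the reformulation of the single-level model.
  This map discards them and renames the remaining variables as in the nested model.
\<close>

definition drop_slack :: "('i, 'j, 'n::finite) gdp \<Rightarrow>
    (('i, 'j) path \<times> 'i, 'j option, 'n) hull_point \<Rightarrow> ('i, 'j, 'n) hull_point" where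
  "drop_slack G = (\<lambda>(x, v, y).
     (x, restrict (v \<circ> extracted) (disjuncts G), restrict (y \<circ> extracted) (disjuncts G)))"

end

(* Give the slack disjunct of an extracted disjunction with parent p the values x - v p and 1 - y p,
   and keep all other variables. Its bounds hold because x - v p is the sum of the disaggregated
   variables v q over the siblings q of p and of all ancestors of p, while 1 - y p is the sum of the
   corresponding y q; the bounds on these v q add up. *)

theory Submission
  imports Defs
begin

section \<open>Paths, disjuncts and finiteness of the nested model\<close>

lemma nodes_snoc_iff:
  "p @ [(i, j)] \<in> nodes G \<longleftrightarrow> p \<in> nodes G \<and> i \<in> disjunctions_at G p \<and> j \<in> disjuncts_of G p i"
  by (auto elim: nodes.cases intro: nodes.child)

text \<open>The condition in \<open>disjunctions\<close> that rules out empty nested disjunctions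
  holds automatically here, since \<open>j\<close> witnesses nonemptiness.\<close>

lemma snoc_in_disjuncts_iff:
  "p @ [(i, j)] \<in> disjuncts G \<longleftrightarrow> (p, i) \<in> disjunctions G \<and> j \<in> disjuncts_of G p i"
  by (auto simp: disjuncts_def disjunctions_def nodes_snoc_iff)

lemma disjuncts_cases:
  assumes "q \<in> disjuncts G"
  obtains p i j where "q = p @ [(i, j)]" "(p, i) \<in> disjunctions G" "j \<in> disjuncts_of G p i"
proof -
  obtain p i j where "q = p @ [(i, j)]"
    using assms by (cases q rule: rev_cases) (auto simp: disjuncts_def)
  then show thesis
    using assms that by (simp add: snoc_in_disjuncts_iff)
qed

lemma parent_in_disjuncts:
  "(p, i) \<in> disjunctions G \<Longrightarrow> p \<noteq> [] \<Longrightarrow> p \<in> disjuncts G"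
  by (simp add: disjunctions_def disjuncts_def)

lemma members_subset_disjuncts:
  "(p, i) \<in> disjunctions G \<Longrightarrow> members G p i \<subseteq> disjuncts G"
  by (auto simp: members_def snoc_in_disjuncts_iff)

text \<open>Each node has finitely many children, so by induction each level is finite; the depth is
  at most \<open>n\<close>, which leaves finitely many levels.\<close>

lemma finite_nodes:
  assumes "multilevel_gdp n G"
  shows "finite (nodes G)"
proof -
  have fin: "finite (disjunctions_at G p)" "\<And>i. i \<in> disjunctions_at G p \<Longrightarrow> finite (disjuncts_of G p i)"
    and depth: "n \<le> length p \<Longrightarrow> disjunctions_at G p = {}" if "p \<in> nodes G" for p
    using assms that by (auto simp: multilevel_gdp_def)
  have "finite {p \<in> nodes G. length p = k}" for k
  proof (induction k)
    case 0
    show ?case by (rule finite_subset[of _ "{[]}"]) auto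
  next
    case (Suc k)
    have "{p \<in> nodes G. length p = Suc k} \<subseteq>
        (\<Union>p\<in>{p \<in> nodes G. length p = k}. \<Union>i\<in>disjunctions_at G p. members G p i)"
    proof
      fix q assume "q \<in> {p \<in> nodes G. length p = Suc k}"
      then show "q \<in> (\<Union>p\<in>{p \<in> nodes G. length p = k}. \<Union>i\<in>disjunctions_at G p. members G p i)"
        by (cases q rule: rev_cases) (fastforce simp: nodes_snoc_iff members_def)+
    qed
    then show ?case
      by (rule finite_subset) (use Suc fin in \<open>auto simp: members_def\<close>)
  qed
  \<comment> \<open>A nonempty node extends a node that still contains a disjunction, hence one of
    length less than \<open>n\<close>; one more step gives length at most \<open>n\<close>.\<close>
  moreover have "length p \<le> n" if "p \<in> nodes G" for p
    using that by cases (use depth not_less_eq_eq in fastforce)+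
  then have "nodes G \<subseteq> (\<Union>k\<le>n. {p \<in> nodes G. length p = k})"
    by auto
  ultimately show ?thesis
    by (meson finite_UN finite_atMost finite_subset)
qed

lemma finite_disjunctions:
  assumes "multilevel_gdp n G"
  shows "finite (disjunctions G)"
proof (rule finite_subset)
  show "disjunctions G \<subseteq> Sigma (nodes G) (disjunctions_at G)"
    by (auto simp: disjunctions_def)
  show "finite (Sigma (nodes G) (disjunctions_at G))"
    using finite_nodes[OF assms] assms by (auto simp: multilevel_gdp_def)
qed

section \<open>Index sets of the single-level model\<close>

lemma extracted_snoc [simp]: "extracted (p @ [(i, j)]) = [((p, i), Some j)]"
  by (simp add: extracted_def)

text \<open>A nonempty path is recovered from its \<open>butlast\<close> and \<open>last\<close>.
  The empty path has to be left out because \<open>last []\<close> is unspecified.\<close>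

lemma inj_on_extracted: "inj_on extracted (- {[]})"
  by (auto simp: inj_on_def extracted_def prod_eq_iff) (metis append_butlast_last_id prod_eqI)

text \<open>Only disjunctions that were nested receive a slack disjunct, hence the restriction to a
  nonempty parent path.\<close>

definition slack_disjuncts ::
  "('i, 'j, 'n::finite) gdp \<Rightarrow> (('i, 'j) path \<times> 'i, 'j option) path set" where
  "slack_disjuncts G = (\<lambda>d. [(d, None)]) ` {(p, i) \<in> disjunctions G. p \<noteq> []}"

text \<open>The single-level model has disjunctions only at the empty path, so every other node is a
  path of length one, ending either in \<open>Some j\<close> (a renamed disjunct) or in
  \<open>None\<close> (a slack disjunct).\<close>

lemma nodes_single_level:
  "nodes (single_level_gdp G) = insert [] (extracted ` disjuncts G \<union> slack_disjuncts G)"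
    (is "?L = ?R")
proof
  show "?L \<subseteq> ?R"
  proof
    fix q assume "q \<in> ?L"
    then show "q \<in> ?R"
    proof cases
      case (child q' d l)
      \<comment> \<open>The parent \<open>q'\<close> contains a disjunction, which forces it to be
        the top level.\<close>
      then obtain p i where d: "d = (p, i)" "(p, i) \<in> disjunctions G" and "q' = []"
        by (cases d) (auto simp: single_level_gdp_def split: if_splits)
      with child consider j where "l = Some j" "j \<in> disjuncts_of G p i" | "l = None" "p \<noteq> []"
        by (auto simp: single_level_gdp_def split: if_splits)
      then show ?thesis
      proof cases
        case 1
        then have "p @ [(i, j)] \<in> disjuncts G"
          using d by (simp add: snoc_in_disjuncts_iff)
        then show ?thesis
          using child d 1 \<open>q' = []\<close> by (metis UnI1 append_Nil extracted_snoc imageI insertI2)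
      next
        case 2
        then show ?thesis
          using child d \<open>q' = []\<close> by (auto simp: slack_disjuncts_def)
      qed
    qed simp
  qed
  have "[((p, i), l)] \<in> ?L"
    if "(p, i) \<in> disjunctions G" "l \<in> disjuncts_of (single_level_gdp G) [] (p, i)" for p i l
    using nodes.child[OF nodes.root, of "(p, i)" "single_level_gdp G" l] that
    by (simp add: single_level_gdp_def)
  then show "?R \<subseteq> ?L"
    by (auto simp: slack_disjuncts_def single_level_gdp_def elim!: disjuncts_cases intro: nodes.root)
qed

lemma disjuncts_single_level:
  "disjuncts (single_level_gdp G) = extracted ` disjuncts G \<union> slack_disjuncts G"
  by (auto simp: disjuncts_def[of "single_level_gdp G"] nodes_single_level extracted_def
      slack_disjuncts_def)

lemma disjunctions_single_level:
  "disjunctions (single_level_gdp G) = Pair [] ` disjunctions G"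
  unfolding disjunctions_def[of "single_level_gdp G"]
  by (auto simp: single_level_gdp_def nodes.root split: if_splits)

lemma members_single_level:
  "members (single_level_gdp G) [] (p, i) =
     extracted ` members G p i \<union> (if p = [] then {} else {[((p, i), None)]})"
  by (auto simp: members_def single_level_gdp_def image_image)

lemma finite_disjuncts_single_level:
  assumes "multilevel_gdp n G"
  shows "finite (disjuncts (single_level_gdp G))"
  unfolding disjuncts_single_level slack_disjuncts_def
  using finite_nodes[OF assms] finite_disjunctions[OF assms]
  by (auto simp: disjuncts_def intro: rev_finite_subset)

section \<open>Extending families of variables to the slack disjuncts\<close>

text \<open>
  \<open>w0\<close> is the value of \<open>w\<close> for the top level: $x$ for the disaggregated variables and 1 for the
  binaries.
\<close>

definition extend_to_slack ::
  "('i, 'j, 'n::finite) gdp \<Rightarrow> 'a::ab_group_add \<Rightarrow> (('i, 'j) path \<Rightarrow> 'a) \<Rightarrow>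
    (('i, 'j) path \<times> 'i, 'j option) path \<Rightarrow> 'a" where
  "extend_to_slack G w0 w = restrict
     (\<lambda>q. case hd q of ((p, i), Some j) \<Rightarrow> w (p @ [(i, j)]) | ((p, i), None) \<Rightarrow> w0 - w p)
     (disjuncts (single_level_gdp G))"

lemma extend_to_slack_extracted:
  "p \<in> disjuncts G \<Longrightarrow> extend_to_slack G w0 w (extracted p) = w p"
  by (auto simp: extend_to_slack_def disjuncts_single_level elim!: disjuncts_cases)

lemma extend_to_slack_None:
  "(p, i) \<in> disjunctions G \<Longrightarrow> p \<noteq> [] \<Longrightarrow> extend_to_slack G w0 w [((p, i), None)] = w0 - w p"
  by (auto simp: extend_to_slack_def disjuncts_single_level slack_disjuncts_def)

lemma sum_extracted:
  assumes "S \<subseteq> disjuncts G"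
  shows "sum f (extracted ` S) = (\<Sum>p\<in>S. f (extracted p))"
proof -
  have "inj_on extracted S"
    by (rule inj_on_subset[OF inj_on_extracted]) (use assms in \<open>auto simp: disjuncts_def\<close>)
  then show ?thesis
    by (simp add: sum.reindex)
qed

lemma sum_extend_to_slack_extracted:
  assumes "S \<subseteq> disjuncts G"
  shows "sum (extend_to_slack G w0 w) (extracted ` S) = sum w S"
  using assms by (simp add: sum_extracted) (intro sum.cong, auto simp: extend_to_slack_extracted)

text \<open>The members contribute \<open>w p\<close> and the slack disjunct
  \<open>w0 - w p\<close>, so the parent value cancels. With \<open>w0\<close> equal to
  \<open>x\<close> this is the new disaggregation equation, with \<open>w0\<close> equal to 1 the
  new cardinality rule.\<close>

lemma sum_extend_to_slack_insert:
  assumes "multilevel_gdp n G" "(p, i) \<in> disjunctions G" "p \<noteq> []"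
    and "sum w (members G p i) = w p"
  shows "sum (extend_to_slack G w0 w) (insert [((p, i), None)] (extracted ` members G p i)) = w0"
proof -
  have "members G p i \<subseteq> nodes G"
    using members_subset_disjuncts[OF assms(2)] by (auto simp: disjuncts_def)
  then have "finite (members G p i)"
    using finite_nodes[OF assms(1)] finite_subset by blast
  then have "sum (extend_to_slack G w0 w) (insert [((p, i), None)] (extracted ` members G p i)) =
      extend_to_slack G w0 w [((p, i), None)] + sum (extend_to_slack G w0 w) (extracted ` members G p i)"
    by (subst sum.insert) (auto simp: members_def)
  then show ?thesis
    using assms by (simp add: extend_to_slack_None sum_extend_to_slack_extracted members_subset_disjuncts)
qed

text \<open>Slack Booleans have coefficient 0 in every logic row, and the renaming of the other
  Booleans is injective, so the left-hand side keeps its value.\<close>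

lemma sum_logic_row_single_level:
  fixes y :: "('i, 'j) path \<Rightarrow> real"
  assumes "multilevel_gdp n G"
  shows "(\<Sum>q\<in>disjuncts (single_level_gdp G).
      (case q of [((p, i), Some j)] \<Rightarrow> a (p @ [(i, j)]) | _ \<Rightarrow> 0) * extend_to_slack G w0 y q) =
    (\<Sum>p\<in>disjuncts G. a p * y p)" (is "(\<Sum>q\<in>_. ?f q) = _")
proof -
  have "sum ?f (disjuncts (single_level_gdp G)) = sum ?f (extracted ` disjuncts G)"
    by (rule sum.mono_neutral_right[OF finite_disjuncts_single_level[OF assms]])
      (auto simp: disjuncts_single_level slack_disjuncts_def)
  also have "\<dots> = (\<Sum>p\<in>disjuncts G. a p * y p)"
    unfolding sum_extracted[OF order_refl]
  proof (rule sum.cong[OF refl])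
    fix q assume "q \<in> disjuncts G"
    then show "?f (extracted q) = a q * y q"
      \<comment> \<open>The value \<open>y q\<close> is rewritten into the extended family, because
        \<open>extracted_snoc\<close> has already put the other side into the form
        \<open>[((p, i), Some j)]\<close>.\<close>
      by (elim disjuncts_cases) (simp add: extend_to_slack_extracted[symmetric, of _ G y w0]
          snoc_in_disjuncts_iff)
  qed
  finally show ?thesis .
qed

section \<open>Bounds for the slack variables\<close>

text \<open>For nonzero \<open>t\<close> the perspectives of the bound constraints are the
  components of \<open>t *\<^sub>R l - v\<close> and \<open>v - t *\<^sub>R u\<close>; for
  \<open>t = 0\<close> the perspective is 0 by convention.\<close>

lemma perspective_bound_constraint_nonpos:
  assumes "h \<in> bound_constraints l u" "t *\<^sub>R l \<le> v" "v \<le> t *\<^sub>R u"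
  shows "perspective h v t \<le> 0"
proof (cases "t = 0")
  case False
  have "t * l $ k \<le> v $ k" "v $ k \<le> t * u $ k" for k
    using assms(2,3) by (simp_all add: less_eq_vec_def)
  then show ?thesis
    using assms(1) False by (auto simp: bound_constraints_def perspective_def right_diff_distrib
        simp flip: mult.assoc)
qed (simp add: perspective_def)

text \<open>In each coordinate \<open>t *\<^sub>R l\<close> lies between 0 and \<open>l\<close>.
  Together with its dual for \<open>sup\<close>, this derives the domain of a disaggregated slack
  variable from its bounds scaled by the binary.\<close>

lemma inf_zero_le_scaleR:
  fixes l :: "real^'n::finite"
  assumes "0 \<le> t" "t \<le> 1"
  shows "inf 0 l \<le> t *\<^sub>R l"
proof -
  have "min 0 (l $ k) \<le> t * l $ k" for k
    using assms mult_left_le_one_le[of "- (l $ k)" t] by (cases "0 \<le> l $ k") auto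
  then show ?thesis
    by (simp add: less_eq_vec_def inf_vec_def inf_min)
qed

lemma scaleR_le_sup_zero:
  fixes u :: "real^'n::finite"
  assumes "0 \<le> t" "t \<le> 1"
  shows "t *\<^sub>R u \<le> sup 0 u"
proof -
  have "t * u $ k \<le> max 0 (u $ k)" for k
    using assms mult_left_le_one_le[of "u $ k" t]
    by (cases "0 \<le> u $ k") (auto simp: mult_nonneg_nonpos)
  then show ?thesis
    by (simp add: less_eq_vec_def sup_vec_def sup_max)
qed

text \<open>Induction along the path: for a child \<open>q\<close> of \<open>p\<close>,
  \<open>x - v q\<close> splits into \<open>x - v p\<close>, bounded by the induction hypothesis,
  and \<open>v p - v q\<close>, the sum of \<open>v\<close> over the siblings of \<open>q\<close>.
  The factors \<open>1 - y p\<close> and \<open>y p - y q\<close> add up to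
  \<open>1 - y q\<close>.\<close>

lemma slack_bounds:
  fixes G :: "('i, 'j, 'n::finite) gdp" and v :: "('i, 'j) path \<Rightarrow> real^'n"
  assumes ml: "multilevel_gdp n G"
    and v_sum: "\<And>p i. (p, i) \<in> disjunctions G \<Longrightarrow> sum v (members G p i) = (if p = [] then x else v p)"
    and y_sum: "\<And>p i. (p, i) \<in> disjunctions G \<Longrightarrow> sum y (members G p i) = (if p = [] then 1 else y p)"
    and bounds: "\<And>p. p \<in> disjuncts G \<Longrightarrow> y p *\<^sub>R l \<le> v p \<and> v p \<le> y p *\<^sub>R u"
    and "p \<in> disjuncts G"
  shows "(1 - y p) *\<^sub>R l \<le> x - v p \<and> x - v p \<le> (1 - y p) *\<^sub>R u"
proof -
  have "p \<in> nodes G" "p \<noteq> []"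
    using assms(5) by (auto simp: disjuncts_def)
  then show ?thesis
  proof (induction p rule: nodes.induct)
    case (child p i j)
    let ?q = "p @ [(i, j)]" and ?S = "members G p i - {p @ [(i, j)]}"
    have pi: "(p, i) \<in> disjunctions G"
      using child.hyps by (auto simp: disjunctions_def)
    have sub: "members G p i \<subseteq> disjuncts G"
      by (rule members_subset_disjuncts[OF pi])
    have fin: "finite (members G p i)"
      using sub finite_nodes[OF ml] by (auto simp: disjuncts_def intro: rev_finite_subset)
    have q: "?q \<in> members G p i"
      using child.hyps by (simp add: members_def)
    have "sum y ?S *\<^sub>R l \<le> sum v ?S"
      unfolding scaleR_left.sum by (rule sum_mono) (use sub bounds in blast)
    moreover have "sum v ?S \<le> sum y ?S *\<^sub>R u"
      unfolding scaleR_left.sum by (rule sum_mono) (use sub bounds in blast)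
    \<comment> \<open>Removing \<open>?q\<close> from its disjunction turns the disaggregation
      equation and the cardinality rule into formulas for the sibling sums.\<close>
    moreover have "sum v ?S = (if p = [] then x else v p) - v ?q"
      "sum y ?S = (if p = [] then 1 else y p) - y ?q"
      using fin q by (simp_all add: sum_diff1 v_sum[OF pi] y_sum[OF pi])
    ultimately have sib:
      "((if p = [] then 1 else y p) - y ?q) *\<^sub>R l \<le> (if p = [] then x else v p) - v ?q"
      "(if p = [] then x else v p) - v ?q \<le> ((if p = [] then 1 else y p) - y ?q) *\<^sub>R u"
      by simp_all
    show ?case
    \<comment> \<open>At level 1 the sibling sums are already the slack values; below it, the bounds
      for \<open>p\<close> are added to those for the siblings.\<close>
    proof (cases "p = []")
      case False
      with child.IH have
        "(1 - y p) *\<^sub>R l \<le> x - v p" "x - v p \<le> (1 - y p) *\<^sub>R u"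
        by auto
      with sib False show ?thesis
        using add_mono[of "(1 - y p) *\<^sub>R l" "x - v p" "(y p - y ?q) *\<^sub>R l" "v p - v ?q"]
          add_mono[of "x - v p" "(1 - y p) *\<^sub>R u" "v p - v ?q" "(y p - y ?q) *\<^sub>R u"]
        by (simp flip: scaleR_add_left)
    qed (use sib in simp)
  qed simp
qed

section \<open>Feasibility of the extended point\<close>

text \<open>The constraints on renamed disjuncts carry over unchanged, so the work lies in the slack
  disjuncts and the equations containing them. The relaxed range of the binaries enters through the
  domains of the disaggregated slack variables.\<close>

lemma hull_constraint_single_level:
  fixes G :: "('i, 'j, 'n::finite) gdp"
  assumes ml: "multilevel_gdp n G"
    and hull: "hull_constraint G (x, v, y)"
    and y01: "\<And>p. p \<in> disjuncts G \<Longrightarrow> y p \<in> {0..1}"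
  shows "hull_constraint (single_level_gdp G) (x, extend_to_slack G x v, extend_to_slack G 1 y)"
proof -
  let ?S = "single_level_gdp G" and ?l = "lower_bound G" and ?u = "upper_bound G"
  let ?v = "extend_to_slack G x v" and ?y = "extend_to_slack G 1 y"
  have v_sum: "sum v (members G p i) = (if p = [] then x else v p)"
    if "(p, i) \<in> disjunctions G" for p i
    using hull that by (fastforce simp: hull_constraint_def)
  have rules: "cardinality_rules G =
      {(Exactly 1, members G [] i) | i. i \<in> disjunctions_at G []} \<union>
      {(Truth p, members G p i) | p i. (p, i) \<in> disjunctions G \<and> p \<noteq> []}"
    using ml by (simp add: multilevel_gdp_def)
  have y_rule: "sum y T = cardinality_value y m" if "(m, T) \<in> cardinality_rules G" for m T
    using hull that by (fastforce simp: hull_constraint_def)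
  \<comment> \<open>Both kinds of cardinality rule are brought into the shape of
    \<open>v_sum\<close>, with 1 in the place of \<open>x\<close>, as \<open>slack_bounds\<close>
    expects.\<close>
  have y_sum: "sum y (members G p i) = (if p = [] then 1 else y p)"
    if "(p, i) \<in> disjunctions G" for p i
  proof (cases "p = []")
    case True
    with that have "(Exactly 1, members G p i) \<in> cardinality_rules G"
      by (auto simp: rules disjunctions_def)
    from y_rule[OF this] True show ?thesis by simp
  next
    case False
    with that have "(Truth p, members G p i) \<in> cardinality_rules G"
      by (auto simp: rules)
    from y_rule[OF this] False show ?thesis by simp
  qed
  have bounds: "y p *\<^sub>R ?l \<le> v p \<and> v p \<le> y p *\<^sub>R ?u" if "p \<in> disjuncts G" for p
    using hull that by (simp add: hull_constraint_def)
  have slack: "(1 - y p) *\<^sub>R ?l \<le> x - v p \<and> x - v p \<le> (1 - y p) *\<^sub>R ?u"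
    if "p \<in> disjuncts G" for p
    using slack_bounds[OF ml _ _ _ that] v_sum y_sum bounds by blast
  have S_sel [simp]: "global_constraints ?S = global_constraints G"
    "lower_bound ?S = ?l" "upper_bound ?S = ?u"
    by (simp_all add: single_level_gdp_def)
  have disj_S: "(\<forall>q\<in>disjuncts ?S. P q) \<longleftrightarrow> (\<forall>p\<in>disjuncts G. P (extracted p)) \<and>
      (\<forall>p i. (p, i) \<in> disjunctions G \<and> p \<noteq> [] \<longrightarrow> P [((p, i), None)])" for P
    by (auto simp: disjuncts_single_level slack_disjuncts_def)
  have "?v \<in> extensional (disjuncts ?S)" "?y \<in> extensional (disjuncts ?S)"
    by (simp_all add: extend_to_slack_def)
  moreover have "\<forall>r\<in>global_constraints G. r x \<le> 0" "?l \<le> x" "x \<le> ?u"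
    using hull by (simp_all add: hull_constraint_def)
  \<comment> \<open>Every disjunction is now at the top level, so its variables must sum to
    \<open>x\<close>: directly for an original level-1 disjunction, by cancellation with the slack
    for an extracted one.\<close>
  moreover have "\<forall>(q, d)\<in>disjunctions ?S.
      (\<Sum>q\<in>members ?S q d. ?v q) = (if q = [] then x else ?v q)"
    using v_sum
    by (auto simp: disjunctions_single_level members_single_level sum_extend_to_slack_extracted
        sum_extend_to_slack_insert[OF ml] members_subset_disjuncts)
  moreover have "\<forall>q\<in>disjuncts ?S. ?y q *\<^sub>R ?l \<le> ?v q \<and> ?v q \<le> ?y q *\<^sub>R ?u"
    unfolding disj_S
    using bounds slack[OF parent_in_disjuncts]
    by (simp add: extend_to_slack_extracted extend_to_slack_None) blast
  moreover have "\<forall>q\<in>disjuncts ?S. \<forall>h\<in>disjunct_constraints ?S q. perspective h (?v q) (?y q) \<le> 0"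
    unfolding disj_S
  proof (intro conjI ballI allI impI)
    fix p h assume p: "p \<in> disjuncts G" and h: "h \<in> disjunct_constraints ?S (extracted p)"
    from p h have "h \<in> disjunct_constraints G p"
      by (auto simp: single_level_gdp_def elim!: disjuncts_cases)
    with p hull show "perspective h (?v (extracted p)) (?y (extracted p)) \<le> 0"
      by (simp add: extend_to_slack_extracted hull_constraint_def)
  next
    fix p i h
    assume "(p, i) \<in> disjunctions G \<and> p \<noteq> []" "h \<in> disjunct_constraints ?S [((p, i), None)]"
    then show "perspective h (?v [((p, i), None)]) (?y [((p, i), None)]) \<le> 0"
      using slack[of p] perspective_bound_constraint_nonpos[of h ?l ?u] parent_in_disjuncts[of p i G]
      by (auto simp: extend_to_slack_None single_level_gdp_def)
  qed
  \<comment> \<open>The renamed rules, including the linking rules without slack, keep both sides;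
    the added rules hold by the choice of \<open>1 - y p\<close>.\<close>
  moreover have "\<forall>(m, T)\<in>cardinality_rules ?S. sum ?y T = cardinality_value ?y m"
  proof -
    have "sum ?y (extracted ` T) = cardinality_value ?y (map_cardinality extracted m)"
      if mT: "(m, T) \<in> cardinality_rules G" for m T
    proof -
      \<comment> \<open>A Boolean on the left of a rule must be an actual disjunct, since only there
        does the extended family agree with \<open>y\<close>.\<close>
      have "T \<subseteq> disjuncts G" and m: "m = Exactly 1 \<or> (\<exists>p\<in>disjuncts G. m = Truth p)"
        using mT members_subset_disjuncts parent_in_disjuncts
        by (fastforce simp: rules disjunctions_def intro: nodes.root)+
      then have "sum ?y (extracted ` T) = sum y T"
        by (simp add: sum_extend_to_slack_extracted)
      with m y_rule[OF mT] show ?thesis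
        by (auto simp: extend_to_slack_extracted)
    qed
    moreover have "sum ?y (insert [((p, i), None)] (extracted ` members G p i)) = 1"
      if "(p, i) \<in> disjunctions G" "p \<noteq> []" for p i
      by (rule sum_extend_to_slack_insert[OF ml that]) (use y_sum that in simp)
    ultimately show ?thesis
      by (auto simp: single_level_gdp_def)
  qed
  moreover have "\<forall>(a, c)\<in>logic_rows ?S. (\<Sum>q\<in>disjuncts ?S. a q * ?y q) \<le> c"
  proof -
    have "logic_rows ?S = (\<lambda>(a, c). (\<lambda>q. case q of
        [((p, i), Some j)] \<Rightarrow> a (p @ [(i, j)]) | _ \<Rightarrow> 0, c)) ` logic_rows G"
      by (simp add: single_level_gdp_def)
    then show ?thesis
      using hull sum_logic_row_single_level[OF ml, of _ 1 y]
      by (auto simp: hull_constraint_def)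
  qed
  moreover have "\<forall>q\<in>disjuncts ?S. inf 0 ?l \<le> ?v q \<and> ?v q \<le> sup 0 ?u"
    unfolding disj_S
  proof (intro conjI ballI allI impI)
    fix p assume "p \<in> disjuncts G"
    with hull show "inf 0 ?l \<le> ?v (extracted p)" "?v (extracted p) \<le> sup 0 ?u"
      by (simp_all add: extend_to_slack_extracted hull_constraint_def)
  next
    fix p i assume pi: "(p, i) \<in> disjunctions G \<and> p \<noteq> []"
    then have p: "p \<in> disjuncts G"
      using parent_in_disjuncts[of p i G] by simp
    with y01 have t: "0 \<le> 1 - y p" "1 - y p \<le> 1"
      by auto
    show "inf 0 ?l \<le> ?v [((p, i), None)]" "?v [((p, i), None)] \<le> sup 0 ?u"
      using pi slack[OF p] inf_zero_le_scaleR[OF t, of ?l] scaleR_le_sup_zero[OF t, of ?u]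
      by (auto simp: extend_to_slack_None intro: order_trans)
  qed
  ultimately show ?thesis
    by (simp add: hull_constraint_def)
qed

section \<open>Inclusion of the relaxed feasible spaces\<close>

lemma feasible_space_continuous_relaxation_hull:
  "(x, v, y) \<in> feasible_space (continuous_relaxation (hull_reformulation G)) \<longleftrightarrow>
     hull_constraint G (x, v, y) \<and> (\<forall>p\<in>disjuncts G. y p \<in> {0..1})"
  by (simp add: feasible_space_def continuous_relaxation_def hull_reformulation_def)

text \<open>On the disjuncts the renaming is undone; outside them both sides are
  \<open>undefined\<close> by extensionality, so the points are equal and not merely equal on the
  index set.\<close>

lemma drop_slack_extend_to_slack:
  assumes "v \<in> extensional (disjuncts G)" "y \<in> extensional (disjuncts G)"
  shows "drop_slack G (x, extend_to_slack G a v, extend_to_slack G b y) = (x, v, y)"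
  using assms
  by (auto simp: drop_slack_def extend_to_slack_extracted restrict_def extensional_def fun_eq_iff)

theorem theorem1:
  fixes n :: nat and G :: "('i, 'j, 'n::finite) gdp"
  assumes "multilevel_gdp n G"
  shows "feasible_space (continuous_relaxation (hull_reformulation G))
    \<subseteq> drop_slack G ` feasible_space (continuous_relaxation (hull_reformulation (single_level_gdp G)))"
proof
  fix z assume z: "z \<in> feasible_space (continuous_relaxation (hull_reformulation G))"
  obtain x v y where z_eq: "z = (x, v, y)"
    by (cases z)
  have hull: "hull_constraint G (x, v, y)" and y01: "\<And>p. p \<in> disjuncts G \<Longrightarrow> y p \<in> {0..1}"
    using z by (simp_all add: z_eq feasible_space_continuous_relaxation_hull)
  let ?z = "(x, extend_to_slack G x v, extend_to_slack G 1 y)"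
  have "extend_to_slack G 1 y q \<in> {0..1}" if "q \<in> disjuncts (single_level_gdp G)" for q
    using that y01 parent_in_disjuncts
    by (fastforce simp: disjuncts_single_level slack_disjuncts_def extend_to_slack_extracted
        extend_to_slack_None)
  then have "?z \<in> feasible_space (continuous_relaxation (hull_reformulation (single_level_gdp G)))"
    using hull_constraint_single_level[OF assms hull y01]
    by (simp add: feasible_space_continuous_relaxation_hull)
  moreover have "z = drop_slack G ?z"
    using hull by (simp add: z_eq drop_slack_extend_to_slack hull_constraint_def)
  ultimately show "z \<in> drop_slack G `
      feasible_space (continuous_relaxation (hull_reformulation (single_level_gdp G)))"
    by (rule rev_image_eqI)
qed

end
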